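(* Let $\alpha$ and $\beta$ be real numbers of the same sign. Then the operator $U:\mathbb{R}[x]\to\mathbb{R}[x]$ given by $$U(p)(x)=\alpha\, p(x)+\beta\, x\,\bigl(p(x)-p(x-1)\bigr)$$ is a discrete multiplier sequence.
   Context: A polynomial in $\mathbb{R}[x]$ is called hyperbolic if all its zeros are real. For a hyperbolic $p$, $\operatorname{mesh}(p)$ is the minimal distance between its roots; if $p$ has a multiple root, then $\operatorname{mesh}(p):=0$; polynomials of degree at most $1$ are defined to have mesh $+\infty$. $\mathcal{HP}^{+}_{\ge 1}$ denotes the set of hyperbolic polynomials with mesh at least $1$ and with only non-negative zeros; by convention the zero polynomial and the nonzero constants belong to $\mathcal{HP}^{+}_{\ge 1}$. The Pochhammer polynomials are $(x)_0=1$, $(x)_i=x(x-1)\cdots(x-i+1)$ for $i\ge 1$. A linear operator on polynomials is called a diagonal finite difference operator if it acts diagonally with respect to the basis $\{(x)_i\}_{i=0}^\infty$. A diagonal finite difference operator $T$ is called a discrete multiplier sequence if $T(\mathcal{HP}^{+}_{\ge 1})\subseteq\mathcal{HP}^{+}_{\ge 1}$. *)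

theory Defs
  imports Complex_Main
    "HOL-Computational_Algebra.Polynomial"
    "HOL-Library.Extended_Real"
begin

definition hyperbolic :: "real poly \<Rightarrow> bool" where
  "hyperbolic p \<longleftrightarrow> (\<forall>z. poly (map_poly complex_of_real p) z = 0 \<longrightarrow> z \<in> \<real>)"

text \<open>
  Only meaningful for hyperbolic polynomials, for which the real zeros are all the zeros.
  For a nonzero polynomial with simple zeros, the infimum below is over a finite set; if moreover
  the polynomial is hyperbolic of degree at least 2, this set is nonempty and the infimum is a
  minimum.
\<close>

definition mesh :: "real poly \<Rightarrow> ereal" where
  "mesh p =
    (if degree p \<le> 1 then \<infinity>
     else if \<exists>x. order x p \<ge> 2 then 0
     else Inf {ereal \<bar>x - y\<bar> | x y. poly p x = 0 \<and> poly p y = 0 \<and> x \<noteq> y})"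

text \<open>
  The zero polynomial is not hyperbolic in the above sense (every complex number is a zero of it),
  so that constants are added by convention.
\<close>

definition HP_plus_ge_1 :: "real poly set" where
  "HP_plus_ge_1 =
    {p. hyperbolic p \<and> mesh p \<ge> 1 \<and> (\<forall>x. poly p x = 0 \<longrightarrow> x \<ge> 0)} \<union> range (\<lambda>c. [:c:])"

text \<open>
  The falling factorial $x(x-1)\cdots(x-i+1)$; the library constant \<^const>\<open>pochhammer\<close> is the
  rising one.
\<close>

definition pochhammer_poly :: "nat \<Rightarrow> real poly" where
  "pochhammer_poly i = (\<Prod>k<i. [:- real k, 1:])"

definition diagonal_finite_difference_operator :: "(real poly \<Rightarrow> real poly) \<Rightarrow> bool" where
  "diagonal_finite_difference_operator T \<longleftrightarrow>
    Vector_Spaces.linear smult smult T \<and>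
    (\<forall>i. \<exists>c. T (pochhammer_poly i) = smult c (pochhammer_poly i))"

definition discrete_multiplier_sequence :: "(real poly \<Rightarrow> real poly) \<Rightarrow> bool" where
  "discrete_multiplier_sequence T \<longleftrightarrow>
    diagonal_finite_difference_operator T \<and> T ` HP_plus_ge_1 \<subseteq> HP_plus_ge_1"

definition U :: "real \<Rightarrow> real \<Rightarrow> real poly \<Rightarrow> real poly" where
  "U \<alpha> \<beta> p = smult \<alpha> p + smult \<beta> ([:0, 1:] * (p - pcompose p [:-1, 1:]))"

lemma poly_U:
  "poly (U \<alpha> \<beta> p) x = \<alpha> * poly p x + \<beta> * x * (poly p x - poly p (x - 1))"
  by (simp add: U_def poly_pcompose)

end

theory Submission
  imports Defs "HOL-Computational_Algebra.Fundamental_Theorem_Algebra"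
begin

text \<open>
  Replacing $(\alpha, \beta)$ by $(-\alpha, -\beta)$ negates $U$, so let $\alpha, \beta \ge 0$,
  not both zero. Let $p$ be a non-constant member of $\mathcal{HP}^{+}_{\ge 1}$ with zero set $A$,
  and write
  $$q(x) = U(p)(x) = (\alpha + \beta x)\, p(x) - \beta x\, p(x-1).$$
  The first summand vanishes at each zero of $p$, the second one at $0$ and at each zero shifted
  to the right by one. Because the zeros of $p$ are at least $1$ apart, the shifted zeros
  interlace with the zeros. Given $a \in A$, let $l \le a$ be the shifted preceding zero, or $0$
  if $a$ is the smallest zero. At $a$ and at $l$ only one summand of $q$ survives, and
  comparing signs gives $q(l)\, q(a) \le 0$, so $q$ has a zero $b(a) \in [l, a]$
  (lemma \<open>U_root_below_root\<close>).

  These zeros are automatically at least $1$ apart: if $a' < a$ then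
  $b(a') + 1 \le a' + 1 \le b(a)$. They are as many as the zeros of $p$, and
  $\deg q \le \deg p$, so $q$ has no other zeros, real or not
  (lemma \<open>U_preserves_HP_plus_ge_1\<close>).

  Membership in $\mathcal{HP}^{+}_{\ge 1}$ is handled in factored form: the non-constant members
  are the polynomials $c \prod_{a \in A} (x - a)$ with $c \ne 0$ and $A$ a finite nonempty set of
  non-negative reals at least $1$ apart (lemmas \<open>HP_plus_ge_1_imp_split\<close> and
  \<open>split_imp_HP_plus_ge_1\<close>).

  Finally $U$ is diagonal, with eigenvalue $\alpha + \beta i$ at $(x)_i$, because
  $x\,(x-1)_i = (x - i)\,(x)_i$.
\<close>

section \<open>Polynomials with simple real zeros\<close>

definition root_product :: "real set \<Rightarrow> real poly" where
  "root_product A = (\<Prod>a\<in>A. [:- a, 1:])"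

lemma poly_root_product: "poly (root_product A) x = (\<Prod>a\<in>A. x - a)"
  by (simp add: root_product_def poly_prod)

lemma poly_root_product_eq_0_iff:
  "finite A \<Longrightarrow> poly (root_product A) x = 0 \<longleftrightarrow> x \<in> A"
  by (auto simp: poly_root_product)

lemma root_product_nonzero: "root_product A \<noteq> 0"
  by (cases "finite A") (auto simp: root_product_def)

lemma map_poly_of_real_mult:
  "map_poly complex_of_real (p * q) = map_poly complex_of_real p * map_poly complex_of_real q"
  by (rule poly_eqI) (simp add: coeff_map_poly coeff_mult)

lemma map_poly_of_real_root_product:
  "map_poly complex_of_real (root_product A) = (\<Prod>a\<in>A. [:- of_real a, 1:])"
  unfolding root_product_def
proof (induction A rule: infinite_finite_induct)
  case (insert a A)
  have "map_poly complex_of_real [:- a, 1:] = [:- of_real a, 1:]"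
    by (simp add: map_poly_pCons)
  then show ?case
    using insert by (simp add: map_poly_of_real_mult del: mult_pCons_left)
qed simp_all

lemma poly_map_poly_of_real:
  "poly (map_poly complex_of_real p) (of_real x) = of_real (poly p x)"
  by (induction p) (simp_all add: map_poly_pCons)

lemma degree_root_product: "degree (root_product A) = card A"
  unfolding root_product_def by (subst degree_prod_sum_eq) auto

lemma root_product_dvd:
  assumes "finite A" "\<And>a. a \<in> A \<Longrightarrow> poly p a = 0"
  shows "root_product A dvd p"
  using assms
proof (induction A arbitrary: p rule: finite_induct)
  case empty
  then show ?case by (simp add: root_product_def)
next
  case (insert a A)
  obtain r where r: "p = [:- a, 1:] * r"
    using insert.prems[of a] unfolding poly_eq_0_iff_dvd by blast
  have "poly r b = 0" if "b \<in> A" for b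
    using insert.prems[of b] insert.hyps that by (auto simp: r)
  then have "root_product A dvd r"
    by (rule insert.IH)
  then have "[:- a, 1:] * root_product A dvd p"
    unfolding r by (rule mult_dvd_mono[OF dvd_refl])
  then show ?case
    using insert.hyps by (simp add: root_product_def)
qed

text \<open>
  A count of zeros suffices to exclude non-real and multiple ones: the cofactor of the linear
  factors has degree $0$. It is through this lemma that $U(p)$ is seen to be hyperbolic.
\<close>

lemma split_if_enough_roots:
  assumes "p \<noteq> 0" "finite A" "\<And>a. a \<in> A \<Longrightarrow> poly p a = 0" "degree p \<le> card A"
  obtains c where "c \<noteq> 0" "p = smult c (root_product A)"
proof -
  obtain r where r: "p = root_product A * r"
    using root_product_dvd[OF assms(2,3)] by blast
  have "r \<noteq> 0"
    using assms(1) r by auto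
  then have "degree r = 0"
    using assms(4) root_product_nonzero[of A]
    by (simp add: r degree_mult_eq degree_root_product)
  then obtain c where "r = [:c:]"
    by (auto elim: degree_eq_zeroE)
  then show ?thesis
    using that[of c] \<open>r \<noteq> 0\<close> by (simp add: r)
qed

text \<open>
  After the real linear factors have been divided out of $p$, the cofactor has no real zero left
  as the zeros of $p$ are simple, and no non-real zero as $p$ is hyperbolic; so it is constant by
  the fundamental theorem of algebra.
\<close>

lemma hyperbolic_simple_roots_split:
  assumes "hyperbolic p" "p \<noteq> 0" "\<And>x. order x p \<le> 1"
  obtains c where "c \<noteq> 0" "p = smult c (root_product {x. poly p x = 0})"
proof -
  define A where "A = {x. poly p x = 0}"
  have fin: "finite A"
    unfolding A_def by (rule poly_roots_finite[OF assms(2)])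
  obtain r where r: "p = root_product A * r"
    using root_product_dvd[OF fin, of p] unfolding A_def by blast
  have "r \<noteq> 0"
    using assms(2) r by auto
  have no_real: "poly r x \<noteq> 0" for x
  proof
    assume rx: "poly r x = 0"
    then have "poly p x = 0"
      by (simp add: r)
    then have "poly (root_product A) x = 0"
      using fin by (simp add: poly_root_product_eq_0_iff A_def)
    then have "order x (root_product A) \<noteq> 0" "order x r \<noteq> 0"
      using rx \<open>r \<noteq> 0\<close> root_product_nonzero by (auto simp: order_root)
    moreover have "order x p = order x (root_product A) + order x r"
      unfolding r by (rule order_mult) (use root_product_nonzero \<open>r \<noteq> 0\<close> in simp)
    ultimately show False
      using assms(3)[of x] by linarith
  qed
  have "constant (poly (map_poly complex_of_real r))"
  proof (rule ccontr)
    assume "\<not> ?thesis"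
    then obtain z where z: "poly (map_poly complex_of_real r) z = 0"
      using fundamental_theorem_of_algebra by blast
    then have "poly (map_poly complex_of_real p) z = 0"
      by (simp add: r map_poly_of_real_mult)
    then have "z \<in> \<real>"
      using assms(1) by (simp add: hyperbolic_def)
    then obtain x where "z = complex_of_real x"
      by (auto elim: Reals_cases)
    then show False
      using z no_real[of x] by (simp add: poly_map_poly_of_real)
  qed
  then have "degree r = 0"
    by (simp add: constant_degree degree_map_poly)
  then obtain c where "r = [:c:]"
    by (auto elim: degree_eq_zeroE)
  then have "c \<noteq> 0" "p = smult c (root_product A)"
    using r \<open>r \<noteq> 0\<close> by simp_all
  then show ?thesis
    using that unfolding A_def by blast
qed

section \<open>Factored form of the polynomials with mesh at least one\<close>

definition separated :: "real set \<Rightarrow> bool" where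
  "separated A \<longleftrightarrow> (\<forall>x\<in>A. \<forall>y\<in>A. x < y \<longrightarrow> x + 1 \<le> y)"

lemma HP_plus_ge_1_imp_split:
  assumes "p \<in> HP_plus_ge_1" "degree p \<noteq> 0"
  obtains c A where "c \<noteq> 0" "finite A" "A \<noteq> {}" "A \<subseteq> {0..}" "separated A"
    "p = smult c (root_product A)"
proof -
  have p0: "p \<noteq> 0"
    using assms(2) by auto
  have hyp: "hyperbolic p" and mesh: "mesh p \<ge> 1" and nonneg: "\<And>x. poly p x = 0 \<Longrightarrow> x \<ge> 0"
    using assms by (auto simp: HP_plus_ge_1_def)
  have ord: "order x p \<le> 1" for x
  proof (cases "degree p \<le> 1")
    case True
    then show ?thesis
      using order_degree[OF p0, of x] by linarith
  next
    case False
    show ?thesis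
    proof (rule ccontr)
      assume "\<not> order x p \<le> 1"
      then have "mesh p = 0"
        using False unfolding mesh_def by (auto simp: not_le Suc_le_eq numeral_2_eq_2)
      then show False
        using mesh by simp
    qed
  qed
  define A where "A = {x. poly p x = 0}"
  obtain c where c: "c \<noteq> 0" "p = smult c (root_product A)"
    using hyperbolic_simple_roots_split[OF hyp p0 ord] unfolding A_def by blast
  have fin: "finite A"
    unfolding A_def by (rule poly_roots_finite[OF p0])
  have card: "degree p = card A"
    using c by (simp add: degree_root_product)
  have "separated A"
    unfolding separated_def
  proof (intro ballI impI)
    fix x y assume xy: "x \<in> A" "y \<in> A" "x < y"
    have "card {x, y} \<le> card A"
      by (rule card_mono[OF fin]) (use xy in auto)
    then have "\<not> degree p \<le> 1"
      using xy(3) by (simp add: card)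
    moreover have "\<not> (\<exists>x. 2 \<le> order x p)"
      using ord by (simp add: not_le less_Suc_eq_le numeral_2_eq_2)
    ultimately have "mesh p = Inf {ereal \<bar>x - y\<bar> | x y. poly p x = 0 \<and> poly p y = 0 \<and> x \<noteq> y}"
      by (simp only: mesh_def if_False)
    also have "\<dots> \<le> ereal \<bar>x - y\<bar>"
      using xy less_imp_neq[OF xy(3)] unfolding A_def by (intro Inf_lower) blast
    finally have "ereal 1 \<le> ereal \<bar>x - y\<bar>"
      by (rule order_trans[OF mesh[unfolded one_ereal_def]])
    then show "x + 1 \<le> y"
      using xy(3) by simp
  qed
  moreover have "A \<noteq> {}"
    using assms(2) card by auto
  ultimately show ?thesis
    using that[OF c(1) fin _ _ _ c(2)] nonneg by (auto simp: A_def)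
qed

lemma split_imp_HP_plus_ge_1:
  assumes "finite A" "A \<subseteq> {0..}" "separated A"
  shows "smult c (root_product A) \<in> HP_plus_ge_1"
proof (cases "c = 0")
  case True
  have "[:0:] \<in> HP_plus_ge_1"
    unfolding HP_plus_ge_1_def by blast
  then show ?thesis
    using True by simp
next
  case c: False
  define p where "p = smult c (root_product A)"
  have root_iff: "poly p x = 0 \<longleftrightarrow> x \<in> A" for x
    using c assms(1) by (simp add: p_def poly_root_product_eq_0_iff)
  have "hyperbolic p"
    unfolding hyperbolic_def
  proof (intro allI impI)
    fix z assume "poly (map_poly complex_of_real p) z = 0"
    then show "z \<in> \<real>"
      using c assms(1) by (auto simp: p_def map_poly_smult map_poly_of_real_root_product poly_prod)
  qed
  moreover have "mesh p \<ge> 1"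
  proof -
    have "order x p < 2" for x
    proof -
      have "root_product A = [:- x, 1:] * root_product (A - {x})" if "x \<in> A"
        unfolding root_product_def by (rule prod.remove[OF assms(1) that])
      then have "order x (root_product A) = 1 + order x (root_product (A - {x}))" if "x \<in> A"
        using that order_mult[of "[:- x, 1:]" "root_product (A - {x})" x] order_power_n_n[of x 1]
          root_product_nonzero[of A] by (simp del: mult_pCons_left)
      moreover have "order x (root_product (A - {x})) = 0"
        using assms(1) by (intro order_0I) (simp add: poly_root_product_eq_0_iff)
      moreover have "order x (root_product A) = 0" if "x \<notin> A"
        using assms(1) that by (intro order_0I) (simp add: poly_root_product_eq_0_iff)
      ultimately have "order x (root_product A) \<le> 1"
        by (cases "x \<in> A") auto
      then show ?thesis
        using c by (simp add: p_def order_smult)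
    qed
    moreover have "1 \<le> Inf {ereal \<bar>x - y\<bar> | x y. poly p x = 0 \<and> poly p y = 0 \<and> x \<noteq> y}"
    proof (rule Inf_greatest)
      fix d assume "d \<in> {ereal \<bar>x - y\<bar> | x y. poly p x = 0 \<and> poly p y = 0 \<and> x \<noteq> y}"
      then obtain x y where xy: "d = ereal \<bar>x - y\<bar>" "x \<in> A" "y \<in> A" "x \<noteq> y"
        by (auto simp: root_iff)
      then have "1 \<le> \<bar>x - y\<bar>"
        using assms(3) by (cases "x < y") (force simp: separated_def)+
      then show "1 \<le> d"
        by (simp add: xy(1) one_ereal_def)
    qed
    ultimately show ?thesis
      by (auto simp: mesh_def not_le[symmetric])
  qed
  ultimately show ?thesis
    using assms(2) by (auto simp: HP_plus_ge_1_def root_iff simp flip: p_def)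
qed

section \<open>The zeros of the image polynomial\<close>

lemma degree_U_le: "degree (U \<alpha> \<beta> p) \<le> degree p"
proof (cases "degree p = 0")
  case True
  then show ?thesis
    by (auto elim!: degree_eq_zeroE simp: U_def)
next
  case False
  \<comment> \<open>The backward difference lowers the degree, since the leading coefficients cancel.\<close>
  have deg: "degree (pcompose p [:-1, 1:]) = degree p"
    by (simp add: degree_pcompose)
  have "lead_coeff (pcompose p [:-1, 1:]) = lead_coeff p"
    by (subst lead_coeff_comp) auto
  then have "coeff (p - pcompose p [:-1, 1:]) (degree p) = 0"
    by (simp add: deg)
  moreover have "degree (p - pcompose p [:-1, 1:]) \<le> degree p"
    by (rule degree_diff_le) (simp_all add: deg)
  ultimately have "degree (p - pcompose p [:-1, 1:]) < degree p"
    using False eq_zero_or_degree_less by fastforce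
  then have "degree ([:0, 1:] * (p - pcompose p [:-1, 1:])) \<le> degree p"
    by (simp add: degree_pCons_eq_if)
  then show ?thesis
    unfolding U_def by (meson degree_add_le degree_smult_le order_trans)
qed

text \<open>
  Let $l$ be the largest among $0$ and the numbers $a' + 1$ with $a' \in A$, $a' < a$. Then
  $l\, p(l - 1) = 0$, and with $q = U(p)$ it follows that
  $q(l)\, q(a) = - (\alpha + \beta l)\, \beta a\, p(l)\, p(a - 1)$. The factors $l - a'$ and
  $a - 1 - a'$ of $p(l)$ and $p(a-1)$ are both non-negative for $a' < a$ and both non-positive
  for $a' \ge a$, so $q(l)\, q(a) \le 0$ and the intermediate value theorem applies.
\<close>

lemma U_root_below_root:
  assumes "\<alpha> \<ge> 0" "\<beta> \<ge> 0" "finite A" "A \<subseteq> {0..}" "separated A" "a \<in> A"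
    and p: "p = smult c (root_product A)"
  shows "\<exists>b. poly (U \<alpha> \<beta> p) b = 0 \<and> 0 \<le> b \<and> b \<le> a \<and> (\<forall>a'\<in>A. a' < a \<longrightarrow> a' + 1 \<le> b)"
proof -
  define L where "L = insert 0 ((\<lambda>x. x + 1) ` {a' \<in> A. a' < a})"
  define l where "l = Max L"
  have fin: "finite L" and "L \<noteq> {}"
    using assms(3) by (auto simp: L_def)
  then have "l \<in> L"
    unfolding l_def by (rule Max_in)
  have "0 \<le> a"
    using assms(4,6) by auto
  have l_ge: "a' + 1 \<le> l" if "a' \<in> A" "a' < a" for a'
    unfolding l_def by (rule Max_ge[OF fin]) (use that in \<open>auto simp: L_def\<close>)
  have "0 \<le> l"
    unfolding l_def by (rule Max_ge[OF fin]) (simp add: L_def)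
  have "l \<le> a"
    using \<open>l \<in> L\<close> \<open>0 \<le> a\<close> assms(5,6) by (auto simp: L_def separated_def)
  have root: "poly p x = 0" if "x \<in> A" for x
    using that assms(3) by (simp add: p poly_root_product_eq_0_iff)
  have "l * poly p (l - 1) = 0"
    using \<open>l \<in> L\<close> root by (auto simp: L_def)
  then have Ul: "poly (U \<alpha> \<beta> p) l = (\<alpha> + \<beta> * l) * poly p l"
    by (simp add: poly_U algebra_simps)
  have Ua: "poly (U \<alpha> \<beta> p) a = - (\<beta> * a * poly p (a - 1))"
    using root[OF assms(6)] by (simp add: poly_U)
  have "0 \<le> (l - a') * (a - 1 - a')" if "a' \<in> A" for a'
  proof (cases "a' < a")
    case True
    then show ?thesis
      using l_ge[OF that] assms(5,6) that by (force simp: separated_def)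
  next
    case False
    then show ?thesis
      using \<open>l \<le> a\<close> by (intro mult_nonpos_nonpos) auto
  qed
  then have "0 \<le> c\<^sup>2 * (\<Prod>a'\<in>A. (l - a') * (a - 1 - a'))"
    by (intro mult_nonneg_nonneg[OF zero_le_power2] prod_nonneg)
  also have "\<dots> = poly p l * poly p (a - 1)"
    by (simp add: p poly_root_product prod.distrib power2_eq_square)
  finally have "0 \<le> (\<alpha> + \<beta> * l) * (\<beta> * a) * (poly p l * poly p (a - 1))"
    using assms(1,2) \<open>0 \<le> l\<close> \<open>0 \<le> a\<close>
    by (intro mult_nonneg_nonneg[of _ "poly p l * poly p (a - 1)"]) simp_all
  then have le: "poly (U \<alpha> \<beta> p) l * poly (U \<alpha> \<beta> p) a \<le> 0"
    by (simp add: Ul Ua mult_ac)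
  have cont: "continuous_on {l..a} (poly (U \<alpha> \<beta> p))"
    by (intro continuous_at_imp_continuous_on ballI poly_isCont)
  have "\<exists>b\<ge>l. b \<le> a \<and> poly (U \<alpha> \<beta> p) b = 0"
  proof (cases "poly (U \<alpha> \<beta> p) l \<le> 0")
    case True
    show ?thesis
    proof (cases "poly (U \<alpha> \<beta> p) l = 0")
      case False
      then have "0 \<le> poly (U \<alpha> \<beta> p) a"
        using True le by (simp add: mult_le_0_iff)
      with True show ?thesis
        using IVT'[of "poly (U \<alpha> \<beta> p)" l 0 a] \<open>l \<le> a\<close> cont by auto
    qed (use \<open>l \<le> a\<close> in auto)
  next
    case False
    then have "poly (U \<alpha> \<beta> p) a \<le> 0"
      using le by (simp add: mult_le_0_iff)
    with False show ?thesis
      using IVT2'[of "poly (U \<alpha> \<beta> p)" a 0 l] \<open>l \<le> a\<close> cont by auto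
  qed
  then show ?thesis
    using l_ge \<open>0 \<le> l\<close> by (meson order_trans)
qed

lemma U_nonzero:
  assumes "\<alpha> \<ge> 0" "\<beta> \<ge> 0" "\<alpha> \<noteq> 0 \<or> \<beta> \<noteq> 0"
    and "finite A" "A \<noteq> {}" "A \<subseteq> {0..}" "c \<noteq> 0"
  shows "U \<alpha> \<beta> (smult c (root_product A)) \<noteq> 0"
proof -
  \<comment> \<open>At one plus the largest zero of \<open>p\<close>, the shifted polynomial vanishes but \<open>p\<close> does not.\<close>
  define m where "m = Max A"
  have "m \<in> A"
    unfolding m_def using assms(4,5) by (rule Max_in)
  moreover have "m + 1 \<notin> A"
    using Max_ge[OF assms(4), of "m + 1"] by (auto simp: m_def)
  ultimately have root: "poly (root_product A) m = 0"
    and nonroot: "poly (root_product A) (m + 1) \<noteq> 0"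
    using assms(4) by (auto simp: poly_root_product_eq_0_iff)
  have "poly (U \<alpha> \<beta> (smult c (root_product A))) (m + 1) =
      (\<alpha> + \<beta> * (m + 1)) * (c * poly (root_product A) (m + 1))"
    by (simp add: poly_U root distrib_right)
  moreover have "0 < \<alpha> + \<beta> * (m + 1)"
  proof (cases "\<beta> = 0")
    case False
    then have "0 < \<beta> * (m + 1)"
      using assms(2,6) \<open>m \<in> A\<close> by (intro mult_pos_pos) auto
    then show ?thesis
      using assms(1) by linarith
  qed (use assms in auto)
  ultimately show ?thesis
    using assms(7) nonroot by auto
qed

lemma U_preserves_HP_plus_ge_1:
  assumes "\<alpha> \<ge> 0" "\<beta> \<ge> 0" "p \<in> HP_plus_ge_1"
  shows "U \<alpha> \<beta> p \<in> HP_plus_ge_1"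
proof -
  have const: "[:k:] \<in> HP_plus_ge_1" for k
    unfolding HP_plus_ge_1_def by blast
  consider "degree p = 0" | "\<alpha> = 0" "\<beta> = 0" | "degree p \<noteq> 0" "\<alpha> \<noteq> 0 \<or> \<beta> \<noteq> 0"
    by blast
  then show ?thesis
  proof cases
    case 1
    then show ?thesis
      using const by (auto elim!: degree_eq_zeroE simp: U_def)
  next
    case 2
    then show ?thesis
      using const[of 0] by (simp add: U_def)
  next
    case 3
    then obtain c A where A: "c \<noteq> 0" "finite A" "A \<noteq> {}" "A \<subseteq> {0..}" "separated A"
      and p: "p = smult c (root_product A)"
      using HP_plus_ge_1_imp_split[OF assms(3)] by metis
    from U_root_below_root[OF assms(1,2) A(2,4,5) _ p]
    obtain b where b: "\<And>a. a \<in> A \<Longrightarrow> poly (U \<alpha> \<beta> p) (b a) = 0 \<and> 0 \<le> b a \<and> b a \<le> a \<and>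
        (\<forall>a'\<in>A. a' < a \<longrightarrow> a' + 1 \<le> b a)"
      by metis
    have step: "b x + 1 \<le> b y" if "x \<in> A" "y \<in> A" "x < y" for x y
      using b[OF that(1)] b[OF that(2)] that by fastforce
    have "inj_on b A"
    proof (rule linorder_inj_onI')
      fix x y assume "x \<in> A" "y \<in> A" "x < y"
      then show "b x \<noteq> b y"
        using step[of x y] by simp
    qed
    have "separated (b ` A)"
      unfolding separated_def
    proof (intro ballI impI)
      fix u v assume "u \<in> b ` A" "v \<in> b ` A" "u < v"
      then obtain x y where xy: "x \<in> A" "y \<in> A" "u = b x" "v = b y"
        by blast
      with \<open>u < v\<close> have "x < y"
        using step[of y x] by (cases x y rule: linorder_cases) auto
      then show "u + 1 \<le> v"
        using step xy by simp
    qed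
    have "degree (U \<alpha> \<beta> p) \<le> card (b ` A)"
      using degree_U_le[of \<alpha> \<beta> p] A(1) \<open>inj_on b A\<close>
      by (simp add: p degree_root_product card_image)
    moreover have "U \<alpha> \<beta> p \<noteq> 0"
      unfolding p using U_nonzero[OF assms(1,2) 3(2) A(2,3,4,1)] .
    ultimately obtain d where "U \<alpha> \<beta> p = smult d (root_product (b ` A))"
      using split_if_enough_roots[of "U \<alpha> \<beta> p" "b ` A"] b A(2) by blast
    moreover have "b ` A \<subseteq> {0..}"
      using b by auto
    ultimately show ?thesis
      using split_imp_HP_plus_ge_1[of "b ` A" d] A(2) \<open>separated (b ` A)\<close> by simp
  qed
qed

lemma uminus_HP_plus_ge_1:
  assumes "p \<in> HP_plus_ge_1"
  shows "- p \<in> HP_plus_ge_1"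
proof (cases "degree p = 0")
  case True
  then obtain k where "p = [:k:]"
    by (auto elim: degree_eq_zeroE)
  then have "- p = [:- k:]"
    by simp
  then show ?thesis
    unfolding HP_plus_ge_1_def by blast
next
  case False
  then obtain c A where A: "finite A" "A \<subseteq> {0..}" "separated A"
    and p: "p = smult c (root_product A)"
    using HP_plus_ge_1_imp_split[OF assms] by metis
  show ?thesis
    using split_imp_HP_plus_ge_1[OF A, of "- c"] by (simp add: p)
qed

section \<open>Diagonality and the theorem\<close>

lemma pochhammer_poly_shift:
  "x * poly (pochhammer_poly i) (x - 1) = (x - real i) * poly (pochhammer_poly i) x"
proof (induction i)
  case 0
  then show ?case by (simp add: pochhammer_poly_def)
next
  case (Suc i)
  have rec: "poly (pochhammer_poly (Suc i)) y = poly (pochhammer_poly i) y * (y - real i)" for y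
    by (simp add: pochhammer_poly_def algebra_simps)
  have "x * poly (pochhammer_poly (Suc i)) (x - 1) =
      (x * poly (pochhammer_poly i) (x - 1)) * (x - 1 - real i)"
    by (simp add: rec)
  also have "\<dots> = (x - real (Suc i)) * poly (pochhammer_poly (Suc i)) x"
    by (simp add: Suc.IH rec)
  finally show ?case .
qed

lemma U_pochhammer_poly:
  "U \<alpha> \<beta> (pochhammer_poly i) = smult (\<alpha> + \<beta> * real i) (pochhammer_poly i)"
proof (rule poly_eq_poly_eq_iff[THEN iffD1], rule ext)
  fix x
  show "poly (U \<alpha> \<beta> (pochhammer_poly i)) x =
      poly (smult (\<alpha> + \<beta> * real i) (pochhammer_poly i)) x"
    using arg_cong[OF pochhammer_poly_shift[of x i], of "\<lambda>t. \<beta> * t"]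
    by (simp add: poly_U algebra_simps)
qed

lemma linear_U: "Vector_Spaces.linear smult smult (U \<alpha> \<beta>)"
  by unfold_locales
     (simp_all add: U_def pcompose_add pcompose_smult smult_add_right smult_diff_right
      smult_add_left algebra_simps)

theorem theorem4:
  fixes \<alpha> \<beta> :: real
  assumes "(\<alpha> \<ge> 0 \<and> \<beta> \<ge> 0) \<or> (\<alpha> \<le> 0 \<and> \<beta> \<le> 0)"
  shows "discrete_multiplier_sequence (U \<alpha> \<beta>)"
proof -
  have "U \<alpha> \<beta> p \<in> HP_plus_ge_1" if "p \<in> HP_plus_ge_1" for p
  proof (cases "\<alpha> \<ge> 0 \<and> \<beta> \<ge> 0")
    case True
    then show ?thesis
      using U_preserves_HP_plus_ge_1 that by blast
  next
    case False
    have "U \<alpha> \<beta> p = - U (- \<alpha>) (- \<beta>) p"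
      by (simp add: U_def)
    moreover have "U (- \<alpha>) (- \<beta>) p \<in> HP_plus_ge_1"
      using assms False that by (intro U_preserves_HP_plus_ge_1) auto
    ultimately show ?thesis
      using uminus_HP_plus_ge_1 by simp
  qed
  moreover have "diagonal_finite_difference_operator (U \<alpha> \<beta>)"
    unfolding diagonal_finite_difference_operator_def
    using linear_U U_pochhammer_poly by blast
  ultimately show ?thesis
    by (auto simp: discrete_multiplier_sequence_def)
qed

end
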